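(* Let $t$ be a prime, $N$ a non-negative integer, $k$ an integer, and $\nu\in\{0,1,2,\ldots,t-1\}$. Let $$\tilde G_{tN+\nu,t}(k,q) := \sum_{\substack{\pi=(1^{f_1},2^{f_2},\ldots,(tN+\nu)^{f_{tN+\nu}})\in\mathcal{P}\\ f_i\le t-1,\ 1\le i\le tN+\nu\\ \mathrm{GBG}^{(t)}(\pi)=k}} q^{|\pi|}$$ be the generating function for partitions with all parts at most $tN+\nu$, each part repeating no more than $t-1$ times, and GBG-rank mod $t$ equal to $k$. Then $$\tilde G_{tN+\nu,t}(k,q) = \frac{q^{tk^2-(t-1)k}\,(\tilde q;\tilde q)_{tN+\nu}}{\displaystyle\prod_{i=0}^{t-1}(\tilde q;\tilde q)_{N+\lceil\frac{\nu-i}{t}\rceil-k\delta_{i,0}+k\delta_{i,t-1}}},\qquad \tilde q := q^t.$$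
   Context: A partition is a non-increasing finite sequence $\pi=(\lambda_1,\lambda_2,\ldots)$ of positive integers (its parts); the empty partition is included. $|\pi|=\sum_i\lambda_i$ is its norm. $\mathcal{P}$ is the set of all partitions. The notation $\pi=(1^{f_1},2^{f_2},\ldots,M^{f_M})$ means that all parts of $\pi$ are at most $M$ and that the part $i$ occurs exactly $f_i\ge0$ times. The Young diagram of $\pi$ has $\lambda_i$ cells in row $i$, left-justified; the cell in row $i$ and column $j$ ($i,j\ge1$) is labeled by the least non-negative integer congruent to $j-i$ modulo $t$. For $0\le s\le t-1$, $r_s(\pi,t)$ is the number of cells of $\pi$ labeled $s$. With $\omega_t=e^{2\pi\sqrt{-1}/t}$, the GBG-rank of $\pi$ mod $t$ is the complex number $$\mathrm{GBG}^{(t)}(\pi)=\sum_{s=0}^{t-1} r_s(\pi,t)\,\omega_t^s.$$ For $L\ge0$, $(a;q)_L=\prod_{m=0}^{L-1}(1-aq^m)$. The usual convention $1/(q;q)_L=0$ for negative integers $L$ is in force, so the right-hand side is $0$ if one of the subscripts in the denominator is negative. $\lceil x\rceil$ is the least integer $\ge x$, and $\delta_{i,j}$ is $1$ if $i=j$ and $0$ otherwise. *)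

theory Defs
  imports Complex_Main "HOL-Computational_Algebra.Computational_Algebra"
begin

definition is_partition :: "nat list \<Rightarrow> bool" where
  "is_partition \<pi> \<longleftrightarrow> sorted_wrt (\<ge>) \<pi> \<and> (\<forall>x\<in>set \<pi>. 0 < x)"

definition norm_part :: "nat list \<Rightarrow> nat" where
  "norm_part \<pi> = sum_list \<pi>"

(* Rows and columns are numbered from 1, list positions from 0. *)
definition young_diagram :: "nat list \<Rightarrow> (nat \<times> nat) set" where
  "young_diagram \<pi> = {(i, j). 1 \<le> i \<and> i \<le> length \<pi> \<and> 1 \<le> j \<and> j \<le> \<pi> ! (i - 1)}"

definition cell_label :: "nat \<Rightarrow> nat \<times> nat \<Rightarrow> int" where
  "cell_label t c = (int (snd c) - int (fst c)) mod int t"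

definition label_count :: "nat \<Rightarrow> nat list \<Rightarrow> nat \<Rightarrow> nat" where
  "label_count s \<pi> t = card {c \<in> young_diagram \<pi>. cell_label t c = int s}"

definition root_of_unity :: "nat \<Rightarrow> complex" where
  "root_of_unity t = exp (2 * complex_of_real pi * \<i> / of_nat t)"

definition GBG_rank :: "nat \<Rightarrow> nat list \<Rightarrow> complex" where
  "GBG_rank t \<pi> = (\<Sum>s = 0..t-1. of_nat (label_count s \<pi> t) * root_of_unity t ^ s)"

definition GBG_partitions :: "nat \<Rightarrow> nat \<Rightarrow> int \<Rightarrow> nat list set" where
  "GBG_partitions M t k =
     {\<pi>. is_partition \<pi> \<and> (\<forall>x\<in>set \<pi>. x \<le> M) \<and>
         (\<forall>i\<in>{1..M}. count_list \<pi> i \<le> t - 1) \<and> GBG_rank t \<pi> = of_int k}"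

(* Since HOL sums over infinite sets are 0, the generating function below is
   meaningful only because this set is finite. *)
lemma finite_GBG_partitions: "finite (GBG_partitions M t k)"
proof -
  have len: "length \<pi> \<le> M * t" if "\<pi> \<in> GBG_partitions M t k" for \<pi>
  proof -
    have sub: "set \<pi> \<subseteq> {1..M}"
      using that by (auto simp: GBG_partitions_def is_partition_def Suc_le_eq)
    have "length \<pi> = (\<Sum>i\<in>set \<pi>. count_list \<pi> i)"
      by (simp add: sum_count_set)
    also have "\<dots> \<le> (\<Sum>i\<in>{1..M}. count_list \<pi> i)"
      by (rule sum_mono2) (use sub in auto)
    also have "\<dots> \<le> (\<Sum>i\<in>{1..M}. t)"
      by (rule sum_mono) (use that in \<open>force simp: GBG_partitions_def\<close>)
    finally show ?thesis by simp
  qed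
  have "GBG_partitions M t k \<subseteq> {\<pi>. set \<pi> \<subseteq> {..M} \<and> length \<pi> \<le> M * t}"
    using len by (auto simp: GBG_partitions_def)
  thus ?thesis
    by (rule finite_subset) (simp add: finite_lists_length_le)
qed

(* The variable q is the indeterminate fps_X. As (q^t;q^t)_L has constant term 1, its inverse
   is a genuine inverse in rat fps. *)
definition GBG_gf :: "nat \<Rightarrow> nat \<Rightarrow> int \<Rightarrow> rat fps" where
  "GBG_gf M t k = (\<Sum>\<pi>\<in>GBG_partitions M t k. fps_X ^ norm_part \<pi>)"

definition qpoch :: "'a::comm_ring_1 \<Rightarrow> 'a \<Rightarrow> nat \<Rightarrow> 'a" where
  "qpoch a q L = (\<Prod>m<L. 1 - a * q ^ m)"

(* 1/(q;q)_L, with the convention that it vanishes for L < 0. *)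
definition inv_qpoch :: "'a::{comm_ring_1,inverse} \<Rightarrow> int \<Rightarrow> 'a" where
  "inv_qpoch q L = (if L < 0 then 0 else inverse (qpoch q q (nat L)))"

definition kdelta :: "nat \<Rightarrow> nat \<Rightarrow> int" where
  "kdelta i j = (if i = j then 1 else 0)"

end

theory Submission
  imports Defs "HOL-Number_Theory.Cong" "HOL-Combinatorics.Multiset_Permutations"
begin

text \<open>
  Let \<open>M = t * N + \<nu>\<close> and let \<open>n\<^sub>j\<close> be the length of column \<open>j\<close> of a partition with parts at
  most \<open>M\<close>. If multiplicities are less than \<open>t\<close>, the partition is determined by the word of the
  residues \<open>c\<^sub>j = (j - 1 - n\<^sub>j) mod t\<close> for \<open>1 \<le> j \<le> M\<close>, and every word over \<open>{0..<t}\<close> arises.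
  Summing over columns, \<open>(1 - \<omega>\<^sup>-\<^sup>1) GBG = (\<Sum>j<M. \<omega> ^ j) - (\<Sum>j. \<omega> ^ c\<^sub>j)\<close>. For prime \<open>t\<close> all
  integer relations between \<open>1, \<dots>, \<omega> ^ (t - 1)\<close> are multiples of \<open>1 + \<dots> + \<omega> ^ (t - 1) = 0\<close>,
  so fixing the GBG-rank amounts to fixing the number of occurrences of each letter.
  With \<open>c\<^sub>M\<^sub>+\<^sub>1 = \<nu>\<close> the multiplicity of \<open>j\<close> is \<open>c\<^sub>j\<^sub>+\<^sub>1 - c\<^sub>j - 1\<close>, plus \<open>t\<close> if \<open>c\<^sub>j\<^sub>+\<^sub>1 \<le> c\<^sub>j\<close>.
  Hence, for a fixed number of occurrences of each letter, the norm is a constant plus \<open>t\<close> times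
  the sum of the weak descent positions. The generating function of this statistic is a
  \<open>q\<close>-multinomial coefficient, up to a power of \<open>q\<close>: removing the last letter gives a recursion in
  which the sum over that letter telescopes.
\<close>

subsection \<open>Integer relations between roots of unity of prime order\<close>

lemma power_mod_eq_power:
  fixes z :: "'a::monoid_mult"
  assumes "z ^ t = 1"
  shows "z ^ (n mod t) = z ^ n"
proof -
  have "z ^ n = z ^ (t * (n div t) + n mod t)" by simp
  also have "\<dots> = z ^ (n mod t)" unfolding power_add power_mult assms by simp
  finally show ?thesis by simp
qed

lemma root_of_unity_power_eq_1_iff:
  assumes "t > 0"
  shows "root_of_unity t ^ n = 1 \<longleftrightarrow> t dvd n"
proof -
  have *: "root_of_unity t = cis (2 * pi / real t)"
    by (simp add: root_of_unity_def cis_conv_exp mult_ac)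
  have pow: "root_of_unity t ^ n = cis (2 * pi * real n / real t)" for n
    by (simp add: * DeMoivre mult_ac)
  have one: "root_of_unity t ^ t = 1"
    using assms by (simp add: pow)
  have "inj_on (\<lambda>k. cis (2 * pi * real k / real t)) {..<t}"
    using bij_betw_roots_unity[OF assms] by (rule bij_betw_imp_inj_on)
  from inj_on_eq_iff[OF this, of "n mod t" 0] assms
  have "root_of_unity t ^ (n mod t) = 1 \<longleftrightarrow> n mod t = 0"
    by (simp add: pow)
  thus ?thesis
    unfolding power_mod_eq_power[OF one] by (simp add: dvd_eq_mod_eq_0)
qed

lemma root_of_unity_nonzero: "t > 0 \<Longrightarrow> root_of_unity t \<noteq> 0"
  by (simp add: root_of_unity_def)

lemma bij_betw_root_of_unity_powers:
  assumes "t > 0"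
  shows "bij_betw (\<lambda>k. root_of_unity t ^ k) {..<t} {z. z ^ t = 1}"
proof -
  have "root_of_unity t ^ k = cis (2 * pi * real k / real t)" for k
    by (simp add: root_of_unity_def flip: exp_of_nat_mult) (simp add: cis_conv_exp mult_ac)
  thus ?thesis
    using bij_betw_roots_unity[OF assms] by simp
qed

text \<open>A geometric series with ratio \<open>\<omega> ^ n\<close>. It filters out the
  coefficients of a polynomial at indices divisible by \<open>t\<close>.\<close>

lemma sum_root_of_unity_powers:
  assumes "t > 0"
  shows "(\<Sum>z | z ^ t = 1. z ^ n) = (if t dvd n then of_nat t else (0::complex))"
proof -
  let ?z = "root_of_unity t"
  have "(\<Sum>z | z ^ t = 1. z ^ n) = (\<Sum>k<t. (?z ^ k) ^ n)"
    by (rule sum.reindex_bij_betw[OF bij_betw_root_of_unity_powers[OF assms], symmetric])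
  also have "\<dots> = (\<Sum>k<t. (?z ^ n) ^ k)"
    by (simp add: mult.commute flip: power_mult)
  also have "\<dots> = (if t dvd n then of_nat t else 0)"
  proof (cases "t dvd n")
    case True
    hence "?z ^ n = 1" using assms by (simp add: root_of_unity_power_eq_1_iff)
    with True show ?thesis by simp
  next
    case False
    hence "?z ^ n \<noteq> 1" using assms by (simp add: root_of_unity_power_eq_1_iff)
    moreover have "(?z ^ n) ^ t = 1"
      using assms by (simp add: root_of_unity_power_eq_1_iff flip: power_mult)
    ultimately show ?thesis using False by (simp add: sum_gp_strict)
  qed
  finally show ?thesis .
qed

abbreviation cpoly :: "int poly \<Rightarrow> complex poly" where
  "cpoly \<equiv> map_poly of_int"

lemma cpoly_mult: "cpoly (p * q) = cpoly p * cpoly q"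
  by (rule poly_eqI) (simp add: coeff_map_poly coeff_mult)

lemma cpoly_add: "cpoly (p + q) = cpoly p + cpoly q"
  by (rule poly_eqI) (simp add: coeff_map_poly)

lemma cpoly_prod: "cpoly (\<Prod>i\<in>I. f i) = (\<Prod>i\<in>I. cpoly (f i))"
  by (induction I rule: infinite_finite_induct) (simp_all add: cpoly_mult)

lemma poly_cpoly_of_int: "poly (cpoly p) (of_int x) = of_int (poly p x)"
  by (induction p) (simp_all add: map_poly_pCons)

lemma poly_cpoly_pcompose_monom: "poly (cpoly (p \<circ>\<^sub>p monom 1 j)) z = poly (cpoly p) (z ^ j)"
  by (induction p)
     (simp_all add: map_poly_pCons pcompose_pCons cpoly_add cpoly_mult map_poly_monom poly_monom)

lemma degree_cpoly: "degree (cpoly p) = degree p"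
  by (rule degree_map_poly) auto

text \<open>For \<open>y = \<omega> ^ b\<close> primality makes \<open>b\<close> invertible modulo
  \<open>t\<close>, so \<open>y\<close> generates all \<open>t\<close>-th roots of unity.\<close>

lemma root_of_unity_power_surj:
  fixes y z :: complex
  assumes "prime t" "y ^ t = 1" "y \<noteq> 1" "z ^ t = 1" "z \<noteq> 1"
  shows "\<exists>j\<in>{1..<t}. y ^ j = z"
proof -
  have t: "t > 0" using assms(1) by (simp add: prime_gt_0_nat)
  let ?w = "root_of_unity t"
  have wt: "?w ^ t = 1" using t by (simp add: root_of_unity_power_eq_1_iff)
  have img: "{z. z ^ t = 1} = (\<lambda>k. ?w ^ k) ` {..<t}"
    using bij_betw_root_of_unity_powers[OF t] by (simp add: bij_betw_def)
  from assms(2) img obtain b where b: "b < t" "y = ?w ^ b" by auto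
  from assms(4) img obtain a where a: "z = ?w ^ a" by auto
  have "b \<noteq> 0" using assms(3) b by (cases b) auto
  hence "coprime b t"
    using assms(1) b(1) by (metis coprime_commute nat_dvd_not_less not_gr_zero prime_imp_coprime)
  then obtain x where x: "[b * x = 1] (mod t)"
    using cong_solve_coprime_nat by auto
  have "y ^ (x * a) = (?w ^ (b * x)) ^ a"
    by (simp add: b(2) mult.assoc flip: power_mult)
  also have "?w ^ (b * x) = ?w ^ (1 mod t)"
    using x power_mod_eq_power[OF wt] by (metis cong_def)
  also have "\<dots> = ?w" by (simp only: power_mod_eq_power[OF wt] power_one_right)
  finally have "y ^ (x * a mod t) = z" by (simp add: power_mod_eq_power[OF assms(2)] a)
  moreover from this have "x * a mod t \<noteq> 0" using assms(5) by (cases "x * a mod t") auto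
  moreover have "x * a mod t < t" using t by simp
  ultimately show ?thesis by force
qed

text \<open>
  The product \<open>P\<close> of the polynomials \<open>h(X ^ j)\<close> with \<open>0 < j < t\<close> vanishes at every
  \<open>t\<close>-th root of unity except \<open>1\<close>. Summing \<open>P\<close> over all \<open>t\<close>-th roots of unity therefore gives
  \<open>P(1) = h(1) ^ (t - 1)\<close>, but it also gives \<open>t\<close> times a sum of coefficients of \<open>P\<close>.
\<close>
lemma prime_dvd_poly_1_if_root_of_unity:
  fixes h :: "int poly"
  assumes "prime t" "z ^ t = 1" "z \<noteq> 1" "poly (cpoly h) z = 0"
  shows "int t dvd poly h 1"
proof -
  have t: "t > 0" using assms(1) by (simp add: prime_gt_0_nat)
  define P where "P = (\<Prod>j\<in>{1..<t}. h \<circ>\<^sub>p monom 1 j)"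
  have P0: "poly (cpoly P) y = 0" if y: "y ^ t = 1" "y \<noteq> 1" for y
  proof -
    obtain j where "j \<in> {1..<t}" "y ^ j = z"
      using root_of_unity_power_surj[OF assms(1) y assms(2,3)] by blast
    thus ?thesis
      using assms(4)
      by (auto simp: P_def cpoly_prod poly_prod poly_cpoly_pcompose_monom)
  qed
  have P1: "poly P 1 = poly h 1 ^ (t - 1)"
    by (simp add: P_def poly_prod poly_pcompose poly_monom)
  have fin: "finite {y::complex. y ^ t = 1}" using t by (intro finite_roots_unity) auto
  have "(\<Sum>y | y ^ t = 1. poly (cpoly P) y) = (\<Sum>y\<in>{1}. poly (cpoly P) y)"
    by (rule sum.mono_neutral_right) (use fin P0 in auto)
  also have "\<dots> = of_int (poly P 1)"
    using poly_cpoly_of_int[of P 1] by simp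
  also have "(\<Sum>y | y ^ t = 1. poly (cpoly P) y) =
      (\<Sum>n\<le>degree P. of_int (coeff P n) * (\<Sum>y | y ^ t = 1. y ^ n))"
    by (simp add: poly_altdef degree_cpoly coeff_map_poly sum_distrib_left)
       (rule sum.swap)
  also have "\<dots> = (\<Sum>n\<le>degree P. of_int (coeff P n * (if t dvd n then int t else 0)))"
    by (rule sum.cong) (auto simp: sum_root_of_unity_powers[OF t])
  also have "\<dots> = of_int (\<Sum>n\<le>degree P. coeff P n * (if t dvd n then int t else 0))"
    by (rule of_int_sum[symmetric])
  finally have "poly P 1 = (\<Sum>n\<le>degree P. coeff P n * (if t dvd n then int t else 0))"
    using of_int_eq_iff by metis
  also have "int t dvd \<dots>" by (rule dvd_sum) auto
  finally have "int t dvd poly h 1 ^ (t - 1)" 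
    using P1 by simp
  thus ?thesis using assms(1) using prime_dvd_power[of "int t"] by simp
qed

section \<open>The cyclotomic polynomial of prime order\<close>

definition cyclo :: "nat \<Rightarrow> int poly" where
  "cyclo t = (\<Sum>s<t. monom 1 s)"

lemma poly_cyclo: "poly (cpoly (cyclo t)) z = (\<Sum>s<t. z ^ s)"
proof -
  have "cpoly (cyclo t) = (\<Sum>s<t. monom 1 s)"
    by (rule poly_eqI) (simp add: cyclo_def coeff_map_poly coeff_sum)
  thus ?thesis by (simp add: poly_sum poly_monom)
qed

lemma coeff_cyclo: "coeff (cyclo t) n = (if n < t then 1 else 0)"
  by (simp add: cyclo_def coeff_sum)

lemma degree_cyclo: "t > 0 \<Longrightarrow> degree (cyclo t) = t - 1"
  by (intro antisym degree_le le_degree) (auto simp: coeff_cyclo)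

text \<open>
  In a proper factorisation \<open>g * h\<close> both factors would vanish at a nontrivial \<open>t\<close>-th root of unity,
  so \<open>t ^ 2\<close> would divide \<open>g(1) * h(1) = t\<close>.
\<close>
lemma irreducible_cyclo:
  assumes "prime t"
  shows "irreducible (cyclo t)"
proof -
  have t: "t > 1" by (rule prime_gt_1_nat) fact
  have lc: "lead_coeff (cyclo t) = 1" using t by (simp add: degree_cyclo coeff_cyclo)
  have const: "g dvd 1" if g: "cyclo t = g * h" "degree g = 0" for g h
  proof -
    have "lead_coeff g * lead_coeff h = 1" using g lc by (metis lead_coeff_mult)
    moreover obtain c where "g = [:c:]" using g(2) by (rule degree_eq_zeroE)
    ultimately have "c * lead_coeff h = 1" by simp
    hence "c dvd 1" by (metis dvd_triv_left)
    thus ?thesis using \<open>g = [:c:]\<close> by (simp add: is_unit_const_poly_iff)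
  qed
  \<comment> \<open>A nonconstant factor has a complex root, which as a root of
    \<open>cyclo t\<close> is a nontrivial \<open>t\<close>-th root of unity.\<close>
  have dvd: "int t dvd poly g 1" if g: "cyclo t = g * h" "degree g \<noteq> 0" for g h
  proof -
    have "\<not> constant (poly (cpoly g))"
      using g(2) by (simp add: constant_degree degree_cpoly)
    then obtain z where z: "poly (cpoly g) z = 0"
      using fundamental_theorem_of_algebra by blast
    hence s0: "(\<Sum>s<t. z ^ s) = 0"
      using g(1) by (simp add: cpoly_mult flip: poly_cyclo)
    have "z ^ t - 1 = (z - 1) * (\<Sum>s<t. z ^ s)"
      by (rule power_diff_1_eq)
    with s0 have "z ^ t = 1" by simp
    moreover have "z \<noteq> 1" using s0 t by auto
    ultimately show ?thesis using prime_dvd_poly_1_if_root_of_unity assms z by blast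
  qed
  show ?thesis
  proof (rule irreducibleI)
    show "cyclo t \<noteq> 0" using lc by auto
    show "\<not> cyclo t dvd 1" using dvd_imp_degree_le[of "cyclo t" 1] t by (auto simp: degree_cyclo)
  next
    fix g h assume gh: "cyclo t = g * h"
    show "g dvd 1 \<or> h dvd 1"
    proof (rule ccontr)
      assume "\<not> (g dvd 1 \<or> h dvd 1)"
      hence "int t dvd poly g 1" "int t dvd poly h 1"
        using const dvd gh by (metis mult.commute)+
      hence "int t * int t dvd poly (cyclo t) 1" by (simp add: gh mult_dvd_mono)
      moreover have "poly (cyclo t) 1 = int t" by (simp add: cyclo_def poly_sum poly_monom)
      ultimately show False using t by simp
    qed
  qed
qed

text \<open>An integer polynomial \<open>g\<close> of least degree annihilating \<omega> divides a
  nonzero multiple of \<open>cyclo t\<close>. The prime element \<open>cyclo t\<close> then divides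
  \<open>g\<close> or the cofactor, whose degree is too small.\<close>

lemma degree_ge_if_root_of_unity:
  assumes "prime t" "p \<noteq> 0" "poly (cpoly p) (root_of_unity t) = 0"
  shows "t - 1 \<le> degree p"
proof -
  let ?z = "root_of_unity t"
  have t: "t > 1" by (rule prime_gt_1_nat) fact
  define Q where "Q = (\<lambda>p. p \<noteq> 0 \<and> poly (cpoly p) ?z = 0)"
  define g where "g = arg_min degree Q"
  have Q: "Q g" and min: "\<And>r. Q r \<Longrightarrow> degree g \<le> degree r"
    using arg_min_nat_lemma[of Q p degree] assms by (auto simp: Q_def g_def)
  have gnz: "g \<noteq> 0" using Q by (simp add: Q_def)
  have z1: "?z \<noteq> 1" "?z ^ t = 1"
    using root_of_unity_power_eq_1_iff[of t 1] root_of_unity_power_eq_1_iff[of t t] t by auto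
  have cy: "poly (cpoly (cyclo t)) ?z = 0"
    using z1 by (simp add: poly_cyclo sum_gp_strict)
  \<comment> \<open>Division with remainder over the integers may require scaling by some nonzero
    \<open>a\<close> first.\<close>
  obtain a q where aq: "a \<noteq> 0" "smult a (cyclo t) = g * q + pseudo_mod (cyclo t) g"
    using pseudo_mod(1)[OF gnz] by blast
  let ?r = "pseudo_mod (cyclo t) g"
  have "poly (cpoly (smult a (cyclo t))) ?z = 0"
    by (simp add: map_poly_smult cy)
  hence "poly (cpoly ?r) ?z = 0"
    using Q by (simp add: aq(2) cpoly_add cpoly_mult Q_def)
  hence r0: "?r = 0"
    using pseudo_mod(2)[OF gnz, of "cyclo t"] min[of ?r] unfolding Q_def by fastforce
  hence eq: "smult a (cyclo t) = g * q" using aq by simp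
  have "cyclo t \<noteq> 0" using irreducible_cyclo[OF assms(1)] by auto
  hence nz: "q \<noteq> 0" using eq aq(1) by auto
  have dg: "degree g + degree q = t - 1"
    using arg_cong[OF eq, of degree] aq(1) nz gnz t by (simp add: degree_mult_eq degree_cyclo)
  have "degree g \<noteq> 0"
  proof
    assume "degree g = 0"
    then obtain c where "g = [:c:]" by (rule degree_eq_zeroE)
    thus False using Q by (simp add: Q_def map_poly_pCons)
  qed
  moreover have "cyclo t dvd g * q"
    using eq by (metis dvd_smult dvd_refl)
  hence "cyclo t dvd g \<or> cyclo t dvd q"
    using irreducible_imp_prime_elem[OF irreducible_cyclo[OF assms(1)]]
    by (simp add: prime_elem_dvd_mult_iff)
  hence "t - 1 \<le> degree g \<or> t - 1 \<le> degree q"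
    using dvd_imp_degree_le[of "cyclo t"] gnz nz t by (auto simp: degree_cyclo)
  ultimately have "t - 1 \<le> degree g" using dg by auto
  also have "degree g \<le> degree p" using min assms by (simp add: Q_def)
  finally show ?thesis .
qed

text \<open>Subtracting \<open>c (t - 1)\<close> times the vanishing sum of all powers of \<omega>
  removes the top coefficient, and a nonzero integer polynomial of degree below \<open>t - 1\<close>
  cannot vanish at \<omega>.\<close>

lemma root_of_unity_sum_eq_0_iff:
  fixes c :: "nat \<Rightarrow> int"
  assumes "prime t"
  shows "(\<Sum>s<t. of_int (c s) * root_of_unity t ^ s) = 0 \<longleftrightarrow> (\<forall>s<t. c s = c (t - 1))"
proof
  let ?z = "root_of_unity t"
  have t: "t > 1" by (rule prime_gt_1_nat) fact
  have z1: "?z \<noteq> 1" "?z ^ t = 1"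
    using root_of_unity_power_eq_1_iff[of t 1] root_of_unity_power_eq_1_iff[of t t] t by auto
  hence z0: "(\<Sum>s<t. ?z ^ s) = 0" by (simp add: sum_gp_strict)
  {
    assume c: "\<forall>s<t. c s = c (t - 1)"
    have "(\<Sum>s<t. of_int (c s) * ?z ^ s) = of_int (c (t - 1)) * (\<Sum>s<t. ?z ^ s)"
      unfolding sum_distrib_left
      by (rule sum.cong[OF refl]) (use c in \<open>metis lessThan_iff\<close>)
    thus "(\<Sum>s<t. of_int (c s) * ?z ^ s) = 0" by (simp add: z0)
  }
  assume c0: "(\<Sum>s<t. of_int (c s) * ?z ^ s) = 0"
  define p where "p = (\<Sum>s<t. monom (c s - c (t - 1)) s)"
  have cf: "coeff p n = (if n < t then c n - c (t - 1) else 0)" for n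
    by (simp add: p_def coeff_sum)
  have "cpoly p = (\<Sum>s<t. monom (of_int (c s - c (t - 1))) s)"
    by (rule poly_eqI) (simp add: coeff_map_poly p_def coeff_sum)
  hence "poly (cpoly p) ?z = (\<Sum>s<t. of_int (c s) * ?z ^ s) - of_int (c (t - 1)) * (\<Sum>s<t. ?z ^ s)"
    by (simp add: poly_sum poly_monom sum_distrib_left sum_subtractf left_diff_distrib)
  hence p0: "poly (cpoly p) ?z = 0" by (simp add: c0 z0)
  have "p = 0"
  proof (rule ccontr)
    assume nz: "p \<noteq> 0"
    hence "t - 1 \<le> degree p" using degree_ge_if_root_of_unity assms p0 by blast
    moreover have "coeff p (degree p) \<noteq> 0" using nz by simp
    hence "degree p < t" and neq: "c (degree p) \<noteq> c (t - 1)" by (auto simp: cf split: if_splits)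
    ultimately have "degree p = t - 1" by linarith
    with neq show False by simp
  qed
  thus "\<forall>s<t. c s = c (t - 1)" using cf by (metis coeff_0 eq_iff_diff_eq_0)
qed

subsection \<open>Words and partitions with bounded multiplicities\<close>

text \<open>
  The head of the list \<open>w\<close> is the last letter \<open>c\<^sub>M\<close> of the word \<open>c\<^sub>1 \<dots> c\<^sub>M\<close>, and \<open>l\<close> plays the role
  of \<open>c\<^sub>M\<^sub>+\<^sub>1\<close>. The part \<open>j\<close> gets the multiplicity \<open>(c\<^sub>j\<^sub>+\<^sub>1 - c\<^sub>j - 1) mod t\<close>, which is
  \<open>gap t c\<^sub>j\<^sub>+\<^sub>1 c\<^sub>j\<close>.
\<close>

definition gap :: "nat \<Rightarrow> nat \<Rightarrow> nat \<Rightarrow> nat" where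
  "gap t l a = (if l \<le> a then t + l else l) - Suc a"

fun word_part :: "nat \<Rightarrow> nat \<Rightarrow> nat list \<Rightarrow> nat list" where
  "word_part t l [] = []"
| "word_part t l (a # w) = replicate (gap t l a) (Suc (length w)) @ word_part t a w"

text \<open>Used modulo \<open>t\<close> for the GBG-rank and exactly for the exponent of
  \<open>x\<close> in the generating function.\<close>

lemma gap_add: "a < t \<Longrightarrow> gap t l a + Suc a = l + (if l \<le> a then t else 0)"
  by (auto simp: gap_def)

lemma gap_less: "a < t \<Longrightarrow> l < t \<Longrightarrow> gap t l a < t"
  by (auto simp: gap_def)

lemma gap_inj: "a < t \<Longrightarrow> b < t \<Longrightarrow> gap t l a = gap t l b \<Longrightarrow> a = b"
  by (auto simp: gap_def split: if_splits)

lemma gap_surj: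
  assumes "f < t" "l < t"
  shows "\<exists>a<t. gap t l a = f"
\<comment> \<open>The witnesses solve \<open>l - a - 1 = f\<close> with \<open>a < l\<close>, and
  \<open>t + l - a - 1 = f\<close> with \<open>l <= a\<close>.\<close>
proof (cases "f < l")
  case True
  thus ?thesis using assms by (intro exI[of _ "l - 1 - f"]) (auto simp: gap_def)
next
  case False
  thus ?thesis using assms by (intro exI[of _ "t + l - 1 - f"]) (auto simp: gap_def)
qed

definition bounded_partitions :: "nat \<Rightarrow> nat \<Rightarrow> nat list set" where
  "bounded_partitions t M = {\<pi>. is_partition \<pi> \<and> (\<forall>x\<in>set \<pi>. x \<le> M) \<and>
     (\<forall>i\<in>{1..M}. count_list \<pi> i \<le> t - 1)}"

definition words :: "nat \<Rightarrow> nat \<Rightarrow> nat list set" where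
  "words t M = {w. set w \<subseteq> {..<t} \<and> length w = M}"

lemma set_word_part: "x \<in> set (word_part t l w) \<Longrightarrow> 0 < x \<and> x \<le> length w"
  by (induction w arbitrary: l) (auto simp: le_Suc_eq)

lemma count_word_part: "count_list (word_part t l w) (Suc (length w)) = 0"
  unfolding count_list_0_iff using set_word_part[of "Suc (length w)" t l w] by linarith

lemma count_list_replicate: "count_list (replicate n x) y = (if x = y then n else 0)"
  by (induction n) auto

lemma sorted_wrt_replicate: "sorted_wrt (\<ge>) (replicate n (x::'a::order))"
  by (induction n) auto

lemma word_part_bounded:
  assumes "w \<in> words t M" "l < t"
  shows "word_part t l w \<in> bounded_partitions t M"
  using assms
proof (induction w arbitrary: l M)
  case Nil
  thus ?case by (auto simp: bounded_partitions_def is_partition_def)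
next
  case (Cons a w)
  then obtain M' where M: "M = Suc M'" "length w = M'" by (auto simp: words_def)
  have a: "a < t" and w: "w \<in> words t M'" using Cons.prems M by (auto simp: words_def)
  note IH = Cons.IH[OF w a]
  have c0: "count_list (word_part t a w) (Suc M') = 0"
    using count_word_part M(2) by metis
  have "is_partition (word_part t l (a # w))"
    using IH M set_word_part[of _ t a w]
    by (auto simp: bounded_partitions_def is_partition_def sorted_wrt_append
        sorted_wrt_replicate le_Suc_eq)
  moreover have "\<forall>x\<in>set (word_part t l (a # w)). x \<le> M"
    using set_word_part[of _ t l "a # w"] M by auto
  moreover have "count_list (word_part t l (a # w)) i \<le> t - 1" if "i \<in> {1..M}" for i
  proof (cases "i = M")
    case True
    thus ?thesis using c0 gap_less[OF a Cons.prems(2)] M by (simp add: count_list_replicate)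
  next
    case False
    hence "count_list (word_part t l (a # w)) i = count_list (word_part t a w) i"
      using M by (simp add: count_list_replicate)
    also have "\<dots> \<le> t - 1" using IH that False M by (auto simp: bounded_partitions_def)
    finally show ?thesis .
  qed
  ultimately show ?case by (simp add: bounded_partitions_def)
qed

text \<open>The multiplicity of the largest admissible part recovers the head of the list, which is
  then the boundary letter for the tail.\<close>

lemma inj_on_word_part: "l < t \<Longrightarrow> inj_on (word_part t l) (words t M)"
proof (induction M arbitrary: l)
  case 0
  thus ?case by (auto simp: inj_on_def words_def)
next
  case (Suc M)
  show ?case
  proof (rule inj_onI)
    fix u v assume u: "u \<in> words t (Suc M)" and v: "v \<in> words t (Suc M)"
      and eq: "word_part t l u = word_part t l v"
    obtain a u' where u': "u = a # u'" "a < t" "u' \<in> words t M" 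
      using u by (cases u) (auto simp: words_def)
    obtain b v' where v': "v = b # v'" "b < t" "v' \<in> words t M" 
      using v by (cases v) (auto simp: words_def)
    have len: "length u' = M" "length v' = M" using u' v' by (auto simp: words_def)
    have "count_list (word_part t c w) (Suc M) = 0" if "length w = M" for c w
      using count_word_part that by metis
    hence "gap t l a = gap t l b"
      using arg_cong[OF eq, of "\<lambda>x. count_list x (Suc M)"] len u' v'
      by (simp add: count_list_replicate)
    hence "a = b" using gap_inj[OF u'(2) v'(2)] by simp
    moreover from this have "word_part t a u' = word_part t a v'"
      using eq len u' v' by simp
    hence "u' = v'" by (rule inj_onD[OF Suc.IH[OF u'(2)]]) (fact u'(3) v'(3))+
    ultimately show "u = v" using u' v' by simp
  qed
qed

lemma partition_split_largest:
  assumes "sorted_wrt (\<ge>) xs" "\<forall>x\<in>set xs. x \<le> Suc (M::nat)"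
  shows "\<exists>n ys. xs = replicate n (Suc M) @ ys \<and> (\<forall>y\<in>set ys. y \<le> M)"
  using assms
proof (induction xs)
  case (Cons x xs)
  show ?case
  proof (cases "x = Suc M")
    case True
    obtain n ys where "xs = replicate n (Suc M) @ ys" "\<forall>y\<in>set ys. y \<le> M"
      using Cons by auto
    thus ?thesis using True by (intro exI[of _ "Suc n"] exI[of _ ys]) simp
  next
    case False
    hence "x \<le> M" using Cons.prems(2) by simp
    moreover have "y \<le> x" if "y \<in> set xs" for y using Cons.prems(1) that by simp
    ultimately have "\<forall>y\<in>set (x # xs). y \<le> M" by (metis order_trans set_ConsD)
    thus ?thesis by (intro exI[of _ 0] exI[of _ "x # xs"]) simp
  qed
qed simp

lemma word_part_surj:
  assumes "\<pi> \<in> bounded_partitions t M" "l < t"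
  shows "\<exists>w\<in>words t M. word_part t l w = \<pi>"
  using assms
proof (induction M arbitrary: l \<pi>)
  case 0
  hence "\<pi> = []" by (cases \<pi>) (auto simp: bounded_partitions_def is_partition_def)
  thus ?case by (auto simp: words_def)
next
  case (Suc M)
  have p: "is_partition \<pi>" "\<forall>x\<in>set \<pi>. x \<le> Suc M" "\<forall>i\<in>{1..Suc M}. count_list \<pi> i \<le> t - 1"
    using Suc.prems(1) by (simp_all add: bounded_partitions_def)
  hence "sorted_wrt (\<ge>) \<pi>" by (simp add: is_partition_def)
  from partition_split_largest[OF this p(2)]
  obtain n ys where \<pi>: "\<pi> = replicate n (Suc M) @ ys" and ys: "\<forall>y\<in>set ys. y \<le> M"
    by (elim exE conjE)
  have "n \<le> count_list \<pi> (Suc M)" by (simp add: \<pi> count_list_replicate)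
  also have "\<dots> \<le> t - 1" using p(3) by simp
  finally have "n < t" using Suc.prems(2) by simp
  from gap_surj[OF this Suc.prems(2)]
  obtain a where a: "a < t" "gap t l a = n" by (elim exE conjE)
  have "is_partition ys"
    using p(1) unfolding \<pi> is_partition_def sorted_wrt_append set_append by blast
  moreover have "count_list ys i \<le> t - 1" if "i \<in> {1..M}" for i
  proof -
    have "count_list ys i \<le> count_list \<pi> i" by (simp add: \<pi>)
    also have "\<dots> \<le> t - 1" using p(3) that by simp
    finally show ?thesis .
  qed
  ultimately have "ys \<in> bounded_partitions t M"
    using ys by (simp add: bounded_partitions_def)
  then obtain w where w: "w \<in> words t M" "word_part t a w = ys" using Suc.IH a(1) by blast
  moreover have "length w = M" using w by (simp add: words_def)
  ultimately have "a # w \<in> words t (Suc M)" "word_part t l (a # w) = \<pi>"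
    using a \<pi> by (simp_all add: words_def)
  thus ?case by blast
qed

lemma bij_betw_word_part:
  assumes "l < t"
  shows "bij_betw (word_part t l) (words t M) (bounded_partitions t M)"
proof (rule bij_betw_imageI)
  show "inj_on (word_part t l) (words t M)" using assms by (rule inj_on_word_part)
  show "word_part t l ` words t M = bounded_partitions t M"
  proof (intro equalityI subsetI)
    fix \<pi> assume "\<pi> \<in> bounded_partitions t M"
    from word_part_surj[OF this assms] show "\<pi> \<in> word_part t l ` words t M" by auto
  qed (auto intro: word_part_bounded[OF _ assms])
qed

subsection \<open>The generating function of words with given content\<close>

lemma qpoch_Suc: "qpoch a q (Suc L) = qpoch a q L * (1 - a * q ^ L)"
  by (simp add: qpoch_def)

text \<open>Since \<open>m a\<close> is the difference of the tail sums \<open>S a\<close> and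
  \<open>S (Suc a)\<close>, each summand is a difference of powers of \<open>y\<close>, with an
  extra factor \<open>y ^ M\<close> from \<open>a = l\<close> on. Both ranges telescope.\<close>

lemma telescoping_letter_sum:
  fixes y :: "'a::comm_ring_1"
  assumes "l < t"
  shows "(\<Sum>a<t. y ^ ((if l \<le> a then \<Sum>s<t. m s else 0) + (\<Sum>s\<in>{Suc a..<t}. m s)) * (1 - y ^ m a)) =
         y ^ (\<Sum>s\<in>{l..<t}. m s) * (1 - y ^ (\<Sum>s<t. m s))"
proof -
  define S where "S = (\<lambda>a. \<Sum>s\<in>{a..<t}. m s)"
  define M where "M = (\<Sum>s<t. m s)"
  have S0: "S 0 = M" by (simp add: S_def M_def lessThan_atLeast0)
  have St: "S t = 0" by (simp add: S_def)
  have step: "S a = m a + S (Suc a)" if "a < t" for a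
    using that by (simp add: S_def sum.atLeast_Suc_lessThan)
  have "(\<Sum>a<t. y ^ ((if l \<le> a then M else 0) + S (Suc a)) * (1 - y ^ m a)) =
     (\<Sum>a<t. (if l \<le> a then y ^ M else 1) * (y ^ S (Suc a) - y ^ S a))"
    by (rule sum.cong) (auto simp: step power_add algebra_simps)
  also have "(\<Sum>a<t. (if l \<le> a then y ^ M else 1) * (y ^ S (Suc a) - y ^ S a)) =
     (\<Sum>a\<in>{0..<l}. (y ^ S (Suc a) - y ^ S a)) + (\<Sum>a\<in>{l..<t}. y ^ M * (y ^ S (Suc a) - y ^ S a))"
  proof -
    have "{..<t} = {0..<l} \<union> {l..<t}" using assms by auto
    thus ?thesis by (simp add: sum.union_disjoint)
  qed
  also have "(\<Sum>a\<in>{0..<l}. (y ^ S (Suc a) - y ^ S a)) = y ^ S l - y ^ M"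
    by (subst sum_Suc_diff') (simp_all add: S0)
  also have "(\<Sum>a\<in>{l..<t}. y ^ M * (y ^ S (Suc a) - y ^ S a)) = y ^ M * (1 - y ^ S l)"
    unfolding sum_distrib_left[symmetric]
    by (subst sum_Suc_diff') (use assms in \<open>simp_all add: St\<close>)
  also have "y ^ S l - y ^ M + y ^ M * (1 - y ^ S l) = y ^ S l * (1 - y ^ M)"
    by (simp add: algebra_simps)
  finally show ?thesis unfolding S_def M_def .
qed

definition word_gf :: "'a::comm_ring_1 \<Rightarrow> nat \<Rightarrow> nat \<Rightarrow> nat multiset \<Rightarrow> 'a" where
  "word_gf x t l m = (\<Sum>w\<in>permutations_of_multiset m. x ^ sum_list (word_part t l w))"

text \<open>Words are grouped by their head \<open>a\<close>, which yields the copies of the part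
  \<open>Suc M\<close> and becomes the boundary letter of the tail.\<close>

lemma word_gf_rec:
  assumes "size m = Suc M"
  shows "word_gf x t l m =
    (\<Sum>a\<in>set_mset m. x ^ (gap t l a * Suc M) * word_gf x t a (m - {#a#}))"
proof -
  have len: "length w = M" if "a \<in># m" "w \<in> permutations_of_multiset (m - {#a#})" for a w
    using that assms by (simp add: length_finite_permutations_of_multiset size_Diff_singleton)
  have "m \<noteq> {#}" using assms by auto
  hence "word_gf x t l m = (\<Sum>w\<in>(\<Union>a\<in>set_mset m. (#) a ` permutations_of_multiset (m - {#a#})).
      x ^ sum_list (word_part t l w))"
    by (simp add: word_gf_def permutations_of_multiset_nonempty)
  also have "\<dots> = (\<Sum>a\<in>set_mset m. \<Sum>w\<in>permutations_of_multiset (m - {#a#}).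
      x ^ sum_list (word_part t l (a # w)))"
    by (subst sum.UNION_disjoint) (auto simp: sum.reindex)
  also have "\<dots> = (\<Sum>a\<in>set_mset m. \<Sum>w\<in>permutations_of_multiset (m - {#a#}).
      x ^ (gap t l a * Suc M) * x ^ sum_list (word_part t a w))"
    by (intro sum.cong refl) (auto simp: len sum_list_replicate power_add)
  finally show ?thesis by (simp add: word_gf_def sum_distrib_left)
qed

text \<open>
  MacMahon's theorem on the major index of multiset permutations, for weak descents and with the
  boundary letter \<open>l\<close> appended; negative exponents and denominators are multiplied out.
\<close>
lemma word_gf_closed:
  fixes x :: "'a::comm_ring_1"
  assumes "set_mset m \<subseteq> {..<t}" "l < t"
  shows "word_gf x t l m * x ^ (sum_mset m + \<Sum>{..size m}) *
           (\<Prod>s<t. qpoch (x ^ t) (x ^ t) (count m s)) =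
         x ^ (size m * l + t * ((\<Sum>s<t. count m s choose 2) + (\<Sum>s\<in>{l..<t}. count m s))) *
           qpoch (x ^ t) (x ^ t) (size m)"
  using assms
proof (induction "size m" arbitrary: m l)
  case 0
  thus ?case by (simp add: word_gf_def qpoch_def numeral_2_eq_2)
next
  case (Suc M)
  let ?y = "x ^ t"
  let ?P = "\<lambda>m. \<Prod>s<t. qpoch ?y ?y (count m s)"
  let ?C = "\<lambda>m. \<Sum>s<t. count m s choose 2"
  have szM: "size m = Suc M" using Suc.hyps by simp
  have cnt: "(\<Sum>s<t. count m s) = size m"
    unfolding size_multiset_overloaded_eq
    by (rule sum.mono_neutral_right) (use Suc.prems in \<open>auto simp: not_in_iff\<close>)
  \<comment> \<open>By the induction hypothesis with boundary letter \<open>a\<close>, each summand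
    of the recursion is a summand of \<open>telescoping_letter_sum\<close> times a factor
    independent of \<open>a\<close>.\<close>
  have step: "x ^ (gap t l a * Suc M) * word_gf x t a (m - {#a#}) * x ^ (sum_mset m + \<Sum>{..size m}) * ?P m
     = x ^ (size m * l + t * ?C m) * qpoch ?y ?y M *
       (?y ^ ((if l \<le> a then \<Sum>s<t. count m s else 0) + (\<Sum>s\<in>{Suc a..<t}. count m s)) * (1 - ?y ^ count m a))"
    if a: "a \<in># m" for a
  proof -
    let ?n = "m - {#a#}"
    have at: "a < t" using a Suc.prems by auto
    have m: "m = add_mset a ?n" using a by simp
    have sz: "size ?n = M" using a szM by (simp add: size_Diff_singleton)
    obtain c where c: "count m a = Suc c" using a by (metis count_greater_zero_iff gr0_implies_Suc)
    have cn: "count ?n a = c" using c by simp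
    have split: "{..<t} = insert a ({..<t} - {a})" using at by auto
    have P: "?P m = ?P ?n * (1 - ?y ^ count m a)"
    proof -
      have "?P m = qpoch ?y ?y (Suc c) * (\<Prod>s\<in>{..<t} - {a}. qpoch ?y ?y (count m s))"
        by (subst split, subst prod.insert) (simp_all add: c)
      also have "(\<Prod>s\<in>{..<t} - {a}. qpoch ?y ?y (count m s)) = (\<Prod>s\<in>{..<t} - {a}. qpoch ?y ?y (count ?n s))"
        by (rule prod.cong) auto
      also have "qpoch ?y ?y (Suc c) = (1 - ?y ^ count m a) * qpoch ?y ?y (count ?n a)"
        by (simp add: qpoch_Suc c)
      also have "(1 - ?y ^ count m a) * qpoch ?y ?y (count ?n a) * (\<Prod>s\<in>{..<t} - {a}. qpoch ?y ?y (count ?n s))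
           = (1 - ?y ^ count m a) * (\<Prod>s\<in>insert a ({..<t} - {a}). qpoch ?y ?y (count ?n s))"
        by (subst prod.insert) (simp_all add: mult.assoc)
      finally show ?thesis using split by (simp add: mult.commute)
    qed
    have C: "?C m = ?C ?n + c"
    proof -
      have "?C m = (Suc c choose 2) + (\<Sum>s\<in>{..<t} - {a}. count m s choose 2)"
        by (subst split, subst sum.insert) (simp_all add: c)
      also have "(\<Sum>s\<in>{..<t} - {a}. count m s choose 2) = (\<Sum>s\<in>{..<t} - {a}. count ?n s choose 2)"
        by (rule sum.cong) auto
      also have "Suc c choose 2 = c + (count ?n a choose 2)"
        unfolding cn by (simp add: numeral_2_eq_2)
      also have "c + (count ?n a choose 2) + (\<Sum>s\<in>{..<t} - {a}. count ?n s choose 2)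
           = c + (\<Sum>s\<in>insert a ({..<t} - {a}). count ?n s choose 2)"
        by (subst sum.insert) simp_all
      finally show ?thesis using split by simp
    qed
    \<comment> \<open>The remaining \<open>c\<close> copies of \<open>a\<close> make up for the loss
      of \<open>c\<close> in \<open>C\<close>, so the exponent involves \<open>m\<close> alone, with
      a tail starting at \<open>Suc a\<close>.\<close>
    have S: "(\<Sum>s\<in>{a..<t}. count ?n s) = c + (\<Sum>s\<in>{Suc a..<t}. count m s)"
      using at cn by (simp add: sum.atLeast_Suc_lessThan)
    have IH: "word_gf x t a ?n * x ^ (sum_mset ?n + \<Sum>{..M}) * ?P ?n =
         x ^ (M * a + t * (?C ?n + (\<Sum>s\<in>{a..<t}. count ?n s))) * qpoch ?y ?y M"
      using Suc.hyps(1)[of ?n a] sz at Suc.prems by (metis (no_types, lifting) in_diffD subset_iff)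
    have sm: "sum_mset m + \<Sum>{..size m} = a + Suc M + (sum_mset ?n + \<Sum>{..M})"
      using arg_cong[OF m, of sum_mset] by (simp add: szM)
    have "x ^ (gap t l a * Suc M) * word_gf x t a ?n * x ^ (sum_mset m + \<Sum>{..size m}) * ?P m =
       x ^ (gap t l a * Suc M + a + Suc M) * (1 - ?y ^ count m a) *
         (word_gf x t a ?n * x ^ (sum_mset ?n + \<Sum>{..M}) * ?P ?n)"
      unfolding P sm by (simp add: power_add algebra_simps)
    also have "\<dots> = x ^ (gap t l a * Suc M + a + Suc M +
          (M * a + t * (?C ?n + (\<Sum>s\<in>{a..<t}. count ?n s)))) * (1 - ?y ^ count m a) * qpoch ?y ?y M"
      unfolding IH by (simp add: power_add algebra_simps)
    also have "gap t l a * Suc M + a + Suc M + (M * a + t * (?C ?n + (\<Sum>s\<in>{a..<t}. count ?n s)))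
        = Suc M * (gap t l a + Suc a) + t * (?C m + (\<Sum>s\<in>{Suc a..<t}. count m s))"
      unfolding C S by (simp add: algebra_simps)
    \<comment> \<open>When \<open>l <= a\<close>, the extra \<open>t\<close> from
      \<open>gap_add\<close> is multiplied by \<open>Suc M\<close>, the total number of
      letters.\<close>
    also have "\<dots> = size m * l + t * ?C m +
        t * ((if l \<le> a then \<Sum>s<t. count m s else 0) + (\<Sum>s\<in>{Suc a..<t}. count m s))"
      unfolding gap_add[OF at] cnt szM by (simp add: algebra_simps)
    finally show ?thesis by (simp add: power_add power_mult algebra_simps)
  qed
  have "word_gf x t l m * x ^ (sum_mset m + \<Sum>{..size m}) * ?P m =
     (\<Sum>a\<in>set_mset m. x ^ (gap t l a * Suc M) * word_gf x t a (m - {#a#}) * x ^ (sum_mset m + \<Sum>{..size m}) * ?P m)"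
    unfolding word_gf_rec[OF szM] sum_distrib_right ..
  also have "\<dots> = x ^ (size m * l + t * ?C m) * qpoch ?y ?y M *
       (\<Sum>a\<in>set_mset m. ?y ^ ((if l \<le> a then \<Sum>s<t. count m s else 0) + (\<Sum>s\<in>{Suc a..<t}. count m s)) * (1 - ?y ^ count m a))"
    by (subst sum_distrib_left[where A = "set_mset m"]) (rule sum.cong[OF refl step])
  \<comment> \<open>Letters missing from \<open>m\<close> contribute 0.\<close>
  also have "(\<Sum>a\<in>set_mset m. ?y ^ ((if l \<le> a then \<Sum>s<t. count m s else 0) + (\<Sum>s\<in>{Suc a..<t}. count m s)) * (1 - ?y ^ count m a)) =
     (\<Sum>a<t. ?y ^ ((if l \<le> a then \<Sum>s<t. count m s else 0) + (\<Sum>s\<in>{Suc a..<t}. count m s)) * (1 - ?y ^ count m a))"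
    by (rule sum.mono_neutral_left) (use Suc.prems in \<open>auto simp: not_in_iff\<close>)
  also have "\<dots> = ?y ^ (\<Sum>s\<in>{l..<t}. count m s) * (1 - ?y ^ (\<Sum>s<t. count m s))"
    by (rule telescoping_letter_sum) fact
  finally show ?case
    unfolding cnt szM qpoch_Suc by (simp add: power_add power_mult algebra_simps)
qed

subsection \<open>The GBG-rank in terms of words\<close>

lemma root_of_unity_power_cong:
  assumes "t > 0" "m mod t = n mod t"
  shows "root_of_unity t ^ m = root_of_unity t ^ n"
proof -
  have one: "root_of_unity t ^ t = 1"
    using assms(1) by (simp add: root_of_unity_power_eq_1_iff)
  show ?thesis
    using power_mod_eq_power[OF one, of m] power_mod_eq_power[OF one, of n] assms(2) by simp
qed

lemma young_diagram_Sigma: "young_diagram \<pi> = (SIGMA i:{1..length \<pi>}. {1..\<pi> ! (i - 1)})"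
  by (auto simp: young_diagram_def)

text \<open>The label matters only modulo \<open>t\<close> as an exponent of \<omega>; the inverse
  replaces negative exponents.\<close>

lemma GBG_rank_eq_sum_cells:
  assumes "t > 0"
  shows "GBG_rank t \<pi> = (\<Sum>c\<in>young_diagram \<pi>. root_of_unity t ^ snd c * inverse (root_of_unity t) ^ fst c)"
proof -
  let ?z = "root_of_unity t"
  have fin: "finite (young_diagram \<pi>)" by (simp add: young_diagram_Sigma)
  have z: "?z \<noteq> 0" using assms by (rule root_of_unity_nonzero)
  have lab: "?z ^ snd c * inverse ?z ^ fst c = ?z ^ nat (cell_label t c)" for c
  proof -
    have "int ((nat (cell_label t c) + fst c) mod t) = int (snd c mod t)"
      using assms by (simp add: cell_label_def zmod_int mod_simps)
    hence "(nat (cell_label t c) + fst c) mod t = snd c mod t" by (simp only: of_nat_eq_iff)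
    hence "?z ^ (nat (cell_label t c) + fst c) = ?z ^ snd c"
      using assms by (intro root_of_unity_power_cong)
    thus ?thesis using z by (simp add: power_add power_inverse field_simps)
  qed
  have "(\<Sum>c\<in>young_diagram \<pi>. ?z ^ snd c * inverse ?z ^ fst c) =
        (\<Sum>c\<in>young_diagram \<pi>. ?z ^ nat (cell_label t c))"
    by (simp only: lab)
  also have "\<dots> = (\<Sum>s\<in>{0..t-1}. \<Sum>c\<in>{c\<in>young_diagram \<pi>. nat (cell_label t c) = s}. ?z ^ nat (cell_label t c))"
    by (rule sum.group[symmetric])
       (use fin assms in \<open>auto simp: cell_label_def nat_le_iff of_nat_diff zle_diff1_eq\<close>)
  also have "\<dots> = (\<Sum>s\<in>{0..t-1}. of_nat (label_count s \<pi> t) * ?z ^ s)"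
  proof (rule sum.cong[OF refl])
    fix s
    have "{c\<in>young_diagram \<pi>. nat (cell_label t c) = s} = {c\<in>young_diagram \<pi>. cell_label t c = int s}"
      using assms by (auto simp: cell_label_def nat_eq_iff2)
    thus "(\<Sum>c\<in>{c\<in>young_diagram \<pi>. nat (cell_label t c) = s}. ?z ^ nat (cell_label t c)) =
        of_nat (label_count s \<pi> t) * ?z ^ s"
      by (simp add: label_count_def)
  qed
  finally show ?thesis by (simp add: GBG_rank_def)
qed

lemma GBG_rank_Nil: "t > 0 \<Longrightarrow> GBG_rank t [] = 0"
  by (simp add: GBG_rank_eq_sum_cells young_diagram_Sigma)

text \<open>Deleting the first row moves the others up by one, whence the factor
  \<open>inverse \<omega>\<close>.\<close>

lemma GBG_rank_Cons:
  assumes "t > 0"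
  shows "GBG_rank t (x # xs) = (\<Sum>j<x. root_of_unity t ^ j) + inverse (root_of_unity t) * GBG_rank t xs"
proof -
  let ?z = "root_of_unity t"
  have z: "?z \<noteq> 0" using assms by (rule root_of_unity_nonzero)
  have rows: "GBG_rank t ys = (\<Sum>i<length ys. \<Sum>j<ys ! i. ?z ^ Suc j * inverse ?z ^ Suc i)" for ys
  proof -
    have "GBG_rank t ys = (\<Sum>i\<in>{1..length ys}. \<Sum>j\<in>{1..ys ! (i - 1)}. ?z ^ j * inverse ?z ^ i)"
      using assms by (simp add: GBG_rank_eq_sum_cells young_diagram_Sigma sum.Sigma case_prod_beta)
    also have "\<dots> = (\<Sum>i<length ys. \<Sum>j\<in>{1..ys ! i}. ?z ^ j * inverse ?z ^ Suc i)"
      by (rule sum.reindex_bij_witness[of _ Suc "\<lambda>i. i - 1"]) auto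
    also have "\<dots> = (\<Sum>i<length ys. \<Sum>j<ys ! i. ?z ^ Suc j * inverse ?z ^ Suc i)"
      by (rule sum.cong[OF refl], rule sum.reindex_bij_witness[of _ Suc "\<lambda>j. j - 1"]) auto
    finally show ?thesis .
  qed
  have cancel: "?z * (inverse ?z * y) = y" for y using z by simp
  show ?thesis
    unfolding rows length_Cons sum.lessThan_Suc_shift
    by (simp add: sum_distrib_left mult_ac cancel)
qed

text \<open>The equal rows form a geometric progression; the factor on the left sums it without
  division.\<close>

lemma GBG_rank_replicate_append:
  assumes "t > 0"
  shows "(1 - inverse (root_of_unity t)) * GBG_rank t (replicate f x @ \<pi>) =
    (\<Sum>j<x. root_of_unity t ^ j) * (1 - inverse (root_of_unity t) ^ f) +
    inverse (root_of_unity t) ^ f * ((1 - inverse (root_of_unity t)) * GBG_rank t \<pi>)"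
proof (induction f)
  case (Suc f)
  let ?u = "inverse (root_of_unity t)" and ?S = "\<Sum>j<x. root_of_unity t ^ j"
  have "(1 - ?u) * GBG_rank t (replicate (Suc f) x @ \<pi>) =
     (1 - ?u) * ?S + ?u * ((1 - ?u) * GBG_rank t (replicate f x @ \<pi>))"
    using assms by (simp add: GBG_rank_Cons algebra_simps)
  also have "\<dots> = ?S * (1 - ?u ^ Suc f) + ?u ^ Suc f * ((1 - ?u) * GBG_rank t \<pi>)"
    unfolding Suc by (simp add: algebra_simps)
  finally show ?case .
qed simp

text \<open>The boundary letter is general because each letter becomes the boundary of the tail. For
  \<open>l = \<nu>\<close> and length \<open>t * N + \<nu>\<close> the factor before the letter sum
  is 1.\<close>

lemma GBG_rank_word_part:
  assumes "t > 0" "set w \<subseteq> {..<t}"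
  shows "(1 - inverse (root_of_unity t)) * GBG_rank t (word_part t l w) =
    (\<Sum>j<length w. root_of_unity t ^ j) -
    root_of_unity t ^ length w * inverse (root_of_unity t) ^ l * (\<Sum>a\<leftarrow>w. root_of_unity t ^ a)"
  using assms(2)
proof (induction w arbitrary: l)
  case Nil
  thus ?case using assms(1) by (simp add: GBG_rank_Nil)
next
  case (Cons a w)
  let ?z = "root_of_unity t"
  let ?u = "inverse ?z" and ?M = "length w" and ?W = "\<Sum>a\<leftarrow>w. ?z ^ a"
  have z: "?z \<noteq> 0" using assms(1) by (rule root_of_unity_nonzero)
  have a: "a < t" using Cons.prems by simp
  have "?z ^ (gap t l a + Suc a) = ?z ^ l"
    unfolding gap_add[OF a] using assms(1) by (intro root_of_unity_power_cong) auto
  hence gap: "?u ^ gap t l a = ?z ^ Suc a * ?u ^ l"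
    using z by (simp add: power_add power_inverse field_simps)
  have IH: "(1 - ?u) * GBG_rank t (word_part t a w) = (\<Sum>j<?M. ?z ^ j) - ?z ^ ?M * ?u ^ a * ?W"
    using Cons by simp
  have aa: "?z ^ a * ?u ^ a = 1" using z by (simp add: power_inverse)
  have "(1 - ?u) * GBG_rank t (word_part t l (a # w)) =
     (\<Sum>j<Suc ?M. ?z ^ j) * (1 - ?z ^ Suc a * ?u ^ l) +
       ?z ^ Suc a * ?u ^ l * ((\<Sum>j<?M. ?z ^ j) - ?z ^ ?M * ?u ^ a * ?W)"
    unfolding word_part.simps GBG_rank_replicate_append[OF assms(1)] gap IH ..
  also have "\<dots> = (\<Sum>j<Suc ?M. ?z ^ j) - ?z ^ Suc ?M * ?u ^ l * (?z ^ a + ?W)"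
  proof -
    \<comment> \<open>\<open>A\<close> and \<open>V\<close> stand for \<open>\<omega> ^ a\<close>
      and its inverse, so the boundary letter of the tail cancels.\<close>
    have "(S + P) * (1 - z * A * U) + z * A * U * (S - P * V * W) = S + P - z * P * U * (A + W)"
      if "A * V = 1" for S P z A U V W :: complex
      using that by algebra
    from this[OF aa, of "\<Sum>j<?M. ?z ^ j" "?z ^ ?M" ?z "?u ^ l" ?W] show ?thesis by simp
  qed
  finally show ?case by simp
qed

subsection \<open>The content of words of a given GBG-rank\<close>

text \<open>
  The number of letters \<open>s\<close> in any word whose partition has GBG-rank \<open>k\<close>; a negative value means
  that there is no such word.
\<close>
definition letter_count :: "nat \<Rightarrow> nat \<Rightarrow> nat \<Rightarrow> int \<Rightarrow> nat \<Rightarrow> int" where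
  "letter_count t N \<nu> k s = int N + (if s < \<nu> then 1 else 0) - k * kdelta s 0 + k * kdelta s (t - 1)"

section \<open>Sums over the prescribed letter counts\<close>

lemma ceiling_quotient_letter:
  assumes "s < t" "\<nu> < t"
  shows "\<lceil>(real \<nu> - real s) / real t\<rceil> = (if s < \<nu> then 1 else 0)"
\<comment> \<open>The quotient lies strictly between -1 and 1.\<close>
proof (cases "s < \<nu>")
  case True
  thus ?thesis using assms by (simp add: ceiling_eq_iff field_simps)
next
  case False
  thus ?thesis using assms by (simp add: ceiling_eq_iff field_simps)
qed

lemma sum_indicator_less:
  fixes f :: "nat \<Rightarrow> int"
  assumes "\<nu> \<le> t"
  shows "(\<Sum>s<t. if s < \<nu> then f s else 0) = (\<Sum>s<\<nu>. f s)"
proof -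
  have "{..<t} \<inter> {s. s < \<nu>} = {..<\<nu>}" using assms by auto
  thus ?thesis by (simp add: sum.If_cases)
qed

lemma double_sum_lessThan: "2 * (\<Sum>s<n. int s) = int n * (int n - 1)"
  by (induction n) (simp_all add: algebra_simps)

lemma sum_letter_count:
  assumes "t > 1" "\<nu> < t"
  shows "(\<Sum>s<t. letter_count t N \<nu> k s) = int (t * N + \<nu>)"
proof -
  have "(\<Sum>s<t. letter_count t N \<nu> k s) =
     (\<Sum>s<t. int N) + (\<Sum>s<t. if s < \<nu> then 1 else 0) - (\<Sum>s<t. k * kdelta s 0) + (\<Sum>s<t. k * kdelta s (t - 1))"
    by (simp add: letter_count_def sum.distrib sum_subtractf)
  also have "(\<Sum>s<t. if s < \<nu> then 1 else 0 :: int) = int \<nu>"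
    using assms by (simp add: sum_indicator_less)
  finally show ?thesis using assms by (simp add: kdelta_def if_distrib cong: if_cong)
qed

lemma weighted_sum_letter_count:
  assumes "t > 1" "\<nu> < t"
  shows "2 * (\<Sum>s<t. letter_count t N \<nu> k s * int s) =
    int N * (int t * (int t - 1)) + int \<nu> * (int \<nu> - 1) + 2 * k * (int t - 1)"
proof -
  have "(\<Sum>s<t. letter_count t N \<nu> k s * int s) =
     int N * (\<Sum>s<t. int s) + (\<Sum>s<t. if s < \<nu> then int s else 0) - (\<Sum>s<t. if s = 0 then k * int s else 0)
      + (\<Sum>s<t. if s = t - 1 then k * int s else 0)"
    unfolding sum_distrib_left sum.distrib[symmetric] sum_subtractf[symmetric]
    by (rule sum.cong) (auto simp: letter_count_def kdelta_def algebra_simps)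
  also have "(\<Sum>s<t. if s < \<nu> then int s else 0) = (\<Sum>s<\<nu>. int s)"
    using assms by (simp add: sum_indicator_less)
  also have "(\<Sum>s<t. if s = 0 then k * int s else 0) = 0"
    by (rule sum.neutral) auto
  also have "(\<Sum>s<t. if s = t - 1 then k * int s else 0) = k * (int t - 1)"
    using assms by (simp add: of_nat_diff)
  finally show ?thesis
    using double_sum_lessThan[of t] double_sum_lessThan[of \<nu>] by algebra
qed

lemma quadratic_sum_letter_count:
  assumes "t > 1" "\<nu> < t"
  shows "(\<Sum>s<t. letter_count t N \<nu> k s * (letter_count t N \<nu> k s - 1)) =
    int t * (int N * (int N - 1)) + 2 * int N * int \<nu> + 2 * k\<^sup>2 - (if \<nu> = 0 then 0 else 2 * k)"
proof -
  \<comment> \<open>Only the distinct letters \<open>0\<close> and \<open>t - 1\<close> carry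
    corrections by \<open>k\<close>. The letter \<open>t - 1\<close> is never below \<nu>, while
    \<open>0\<close> is unless \<open>\<nu> = 0\<close>.\<close>
  have "(\<Sum>s<t. letter_count t N \<nu> k s * (letter_count t N \<nu> k s - 1)) =
     (\<Sum>s<t. int N * (int N - 1)) + (\<Sum>s<t. if s < \<nu> then 2 * int N else 0)
      + (\<Sum>s<t. if s = 0 then k\<^sup>2 - k * (2 * int N - 1 + (if \<nu> = 0 then 0 else 2)) else 0)
      + (\<Sum>s<t. if s = t - 1 then k\<^sup>2 + k * (2 * int N - 1) else 0)"
    unfolding sum.distrib[symmetric]
    by (rule sum.cong) (use assms in \<open>auto simp: letter_count_def kdelta_def power2_eq_square algebra_simps\<close>)
  also have "(\<Sum>s<t. if s < \<nu> then 2 * int N else 0) = 2 * int N * int \<nu>"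
    using assms by (simp add: sum_indicator_less)
  finally show ?thesis
    by (rule trans) (use assms in \<open>cases "\<nu> = 0"; simp add: algebra_simps\<close>)
qed

text \<open>The letter \<open>0\<close> is in range only for \<open>\<nu> = 0\<close>, and then the
  two corrections cancel.\<close>

lemma upper_sum_letter_count:
  assumes "t > 1" "\<nu> < t"
  shows "(\<Sum>s\<in>{\<nu>..<t}. letter_count t N \<nu> k s) = (int t - int \<nu>) * int N + (if \<nu> = 0 then 0 else k)"
proof -
  have "(\<Sum>s\<in>{\<nu>..<t}. letter_count t N \<nu> k s) =
     (\<Sum>s\<in>{\<nu>..<t}. int N) - (\<Sum>s\<in>{\<nu>..<t}. if s = 0 then k else 0) + (\<Sum>s\<in>{\<nu>..<t}. if s = t - 1 then k else 0)"
    unfolding sum.distrib[symmetric] sum_subtractf[symmetric]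
    by (rule sum.cong) (auto simp: letter_count_def kdelta_def)
  thus ?thesis using assms by (auto simp: of_nat_diff)
qed

lemma sum_mset_eq_sum_count:
  assumes "set_mset m \<subseteq> {..<t}"
  shows "sum_mset m = (\<Sum>s<t. count m s * s)"
  using assms
proof (induction m)
  case (add a m)
  have "(\<Sum>s<t. count (add_mset a m) s * s) = (\<Sum>s<t. count m s * s) + (\<Sum>s<t. if s = a then s else 0)"
    unfolding sum.distrib[symmetric] by (rule sum.cong) auto
  thus ?case using add by simp
qed simp

lemma size_eq_sum_count:
  fixes m :: "nat multiset"
  assumes "set_mset m \<subseteq> {..<t}"
  shows "size m = (\<Sum>s<t. count m s)"
  unfolding size_multiset_overloaded_eq
  by (rule sum.mono_neutral_left) (use assms in \<open>auto simp: not_in_iff\<close>)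

text \<open>Compares the two powers of \<open>x\<close> in \<open>word_gf_closed\<close> for
  \<open>l = \<nu>\<close>. Doubling turns binomials and triangular numbers into integer
  polynomials.\<close>

lemma exponent_identity:
  assumes "t > 1" "\<nu> < t" "set_mset m \<subseteq> {..<t}"
    and cnt: "\<And>s. s < t \<Longrightarrow> int (count m s) = letter_count t N \<nu> k s"
  shows "size m * \<nu> + t * ((\<Sum>s<t. count m s choose 2) + (\<Sum>s\<in>{\<nu>..<t}. count m s)) =
         sum_mset m + \<Sum>{..size m} + nat (int t * k\<^sup>2 - (int t - 1) * k)"
proof -
  let ?M = "t * N + \<nu>" and ?e = "int t * k\<^sup>2 - (int t - 1) * k"
  have "int (size m) = (\<Sum>s<t. letter_count t N \<nu> k s)"
    unfolding size_eq_sum_count[OF assms(3)] of_nat_sum by (rule sum.cong) (auto simp: cnt)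
  also have "\<dots> = int ?M" using assms(1,2) by (rule sum_letter_count)
  finally have size: "size m = ?M" by (simp only: of_nat_eq_iff)
  have "int (sum_mset m) = (\<Sum>s<t. letter_count t N \<nu> k s * int s)"
    unfolding sum_mset_eq_sum_count[OF assms(3)] of_nat_sum by (rule sum.cong) (auto simp: cnt)
  hence s1: "2 * int (sum_mset m) = int N * (int t * (int t - 1)) + int \<nu> * (int \<nu> - 1) + 2 * k * (int t - 1)"
    using weighted_sum_letter_count[OF assms(1,2)] by simp
  have ch: "2 * int (n choose 2) = int n * (int n - 1)" for n
    by (induction n) (simp_all add: numeral_2_eq_2 algebra_simps)
  have "2 * int (\<Sum>s<t. count m s choose 2) =
      (\<Sum>s<t. letter_count t N \<nu> k s * (letter_count t N \<nu> k s - 1))"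
    unfolding of_nat_sum sum_distrib_left by (rule sum.cong) (auto simp: ch cnt)
  hence s2: "2 * int (\<Sum>s<t. count m s choose 2) =
      int t * (int N * (int N - 1)) + 2 * int N * int \<nu> + 2 * k\<^sup>2 - (if \<nu> = 0 then 0 else 2 * k)"
    using quadratic_sum_letter_count[OF assms(1,2)] by simp
  have "int (\<Sum>s\<in>{\<nu>..<t}. count m s) = (\<Sum>s\<in>{\<nu>..<t}. letter_count t N \<nu> k s)"
    unfolding of_nat_sum by (rule sum.cong) (auto simp: cnt)
  hence s3: "int (\<Sum>s\<in>{\<nu>..<t}. count m s) = (int t - int \<nu>) * int N + (if \<nu> = 0 then 0 else k)"
    using upper_sum_letter_count[OF assms(1,2)] by simp
  have s4: "2 * int (\<Sum>{..n}) = int n * (int n + 1)" for n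
    by (induction n) (simp_all add: algebra_simps)
  \<comment> \<open>This makes \<open>nat\<close> harmless; for \<open>k > 0\<close> it rests on
    \<open>k <= k ^ 2\<close>.\<close>
  have e: "?e \<ge> 0"
  proof (cases "k \<le> 0")
    case True
    hence "(int t - 1) * k \<le> 0" using assms(1) by (intro mult_nonneg_nonpos) auto
    moreover have "int t * k\<^sup>2 \<ge> 0" by simp
    ultimately show ?thesis by linarith
  next
    case False
    have "(int t - 1) * k \<le> int t * k" using False by (intro mult_right_mono) auto
    also have "int t * k \<le> int t * k\<^sup>2"
      using False by (intro mult_left_mono) (simp_all add: power2_eq_square)
    finally show ?thesis by simp
  qed
  define A B where "A = int (\<Sum>s<t. count m s choose 2)" and "B = int (\<Sum>s\<in>{\<nu>..<t}. count m s)"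
  have "2 * (int ?M * int \<nu> + int t * (A + B)) =
      2 * int (sum_mset m) + 2 * int (\<Sum>{..?M}) + 2 * ?e"
  proof -
    \<comment> \<open>The term depending on whether \<nu> is 0 enters \<open>A\<close> as
      \<open>- d\<close> and \<open>B\<close> as \<open>d\<close>, so it cancels in
      \<open>A + B\<close>.\<close>
    define d where "d = (if \<nu> = 0 then 0 else k)"
    have alg: "2 * ((T * n + v) * v + T * (A + B)) = 2 * C + 2 * E + 2 * (T * k\<^sup>2 - (T - 1) * k)"
      if "2 * C = n * (T * (T - 1)) + v * (v - 1) + 2 * k * (T - 1)"
        "2 * A = T * (n * (n - 1)) + 2 * n * v + 2 * k\<^sup>2 - 2 * d" "B = (T - v) * n + d"
        "2 * E = (T * n + v) * (T * n + v + 1)" for T n v A B C E d :: int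
      using that by algebra
    have "2 * A = int t * (int N * (int N - 1)) + 2 * int N * int \<nu> + 2 * k\<^sup>2 - 2 * d"
      using s2 by (simp add: A_def d_def)
    moreover have "B = (int t - int \<nu>) * int N + d" using s3 by (simp add: B_def d_def)
    moreover have "2 * int (\<Sum>{..?M}) = (int t * int N + int \<nu>) * (int t * int N + int \<nu> + 1)"
      using s4[of ?M] by simp
    ultimately show ?thesis
      using alg[OF s1] unfolding of_nat_add of_nat_mult by blast
  qed
  hence "int (size m * \<nu> + t * ((\<Sum>s<t. count m s choose 2) + (\<Sum>s\<in>{\<nu>..<t}. count m s))) =
         int (sum_mset m + \<Sum>{..size m} + nat ?e)"
    using e unfolding size A_def B_def of_nat_add of_nat_mult by simp
  thus ?thesis by (simp only: of_nat_eq_iff)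
qed

section \<open>Rank and content of a word\<close>

lemma sum_list_map_eq_sum_count_list:
  fixes w :: "nat list" and f :: "nat \<Rightarrow> 'a::comm_semiring_1"
  assumes "set w \<subseteq> {..<t}"
  shows "(\<Sum>a\<leftarrow>w. f a) = (\<Sum>s<t. of_nat (count_list w s) * f s)"
  using assms
proof (induction w)
  case (Cons a w)
  have "(\<Sum>s<t. of_nat (count_list (a # w) s) * f s) =
      (\<Sum>s<t. if s = a then f s else 0) + (\<Sum>s<t. of_nat (count_list w s) * f s)"
    unfolding sum.distrib[symmetric] by (rule sum.cong) (auto simp: algebra_simps)
  thus ?case using Cons by simp
qed simp

text \<open>The prescribed counts satisfy the rank equation, so rank \<open>k\<close> means that the
  differences of the counts form a relation between powers of \<omega> and hence are constant. Both
  counts have the same total, so the constant is 0.\<close>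

lemma GBG_rank_word_part_eq_iff:
  assumes "prime t" "\<nu> < t" "w \<in> words t (t * N + \<nu>)"
  shows "GBG_rank t (word_part t \<nu> w) = of_int k \<longleftrightarrow>
    (\<forall>s<t. int (count_list w s) = letter_count t N \<nu> k s)"
proof -
  let ?z = "root_of_unity t" and ?c = "letter_count t N \<nu> k"
  let ?M = "t * N + \<nu>" and ?W = "\<Sum>a\<leftarrow>w. root_of_unity t ^ a"
  have t: "t > 1" by (rule prime_gt_1_nat) fact
  have z1: "?z \<noteq> 1" and zt: "?z ^ t = 1"
    using root_of_unity_power_eq_1_iff[of t 1] root_of_unity_power_eq_1_iff[of t t] t by auto
  have z: "?z \<noteq> 0" using t by (intro root_of_unity_nonzero) auto
  have w: "set w \<subseteq> {..<t}" "length w = ?M" using assms(3) by (auto simp: words_def)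
  have zM: "?z ^ ?M = ?z ^ \<nu>" using t by (intro root_of_unity_power_cong) auto
  have inv: "inverse ?z = ?z ^ (t - 1)"
  proof -
    have "?z * ?z ^ (t - 1) = 1" using zt t by (metis Suc_diff_1 less_trans power_Suc zero_less_one)
    thus ?thesis by (rule inverse_unique)
  qed
  have block: "(\<Sum>j<?M. ?z ^ j) = (\<Sum>j<\<nu>. ?z ^ j)" and full: "(\<Sum>j<t. ?z ^ j) = 0"
    using z1 by (simp_all add: sum_gp_strict zM zt)
  \<comment> \<open>The corrections at \<open>0\<close> and \<open>t - 1\<close> give
    \<open>k\<close> times \<open>\<omega> ^ (t - 1) - 1\<close>, where
    \<open>\<omega> ^ (t - 1)\<close> is \<open>inverse \<omega>\<close>; the constant
    \<open>N\<close> multiplies a vanishing sum.\<close>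
  have c: "(\<Sum>s<t. of_int (?c s) * ?z ^ s) = (\<Sum>j<?M. ?z ^ j) - of_int k * (1 - inverse ?z)"
  proof -
    have "(\<Sum>s<t. of_int (?c s) * ?z ^ s) = of_nat N * (\<Sum>s<t. ?z ^ s) +
       (\<Sum>s<t. if s \<in> {..<\<nu>} then ?z ^ s else 0) - (\<Sum>s<t. if s = 0 then of_int k * ?z ^ s else 0) +
       (\<Sum>s<t. if s = t - 1 then of_int k * ?z ^ s else 0)"
      unfolding sum_distrib_left sum.distrib[symmetric] sum_subtractf[symmetric]
    proof (rule sum.cong[OF refl])
      fix s
      have "of_int (?c s) = of_nat N + (if s \<in> {..<\<nu>} then 1 else 0) - (if s = 0 then of_int k else 0) +
          (if s = t - 1 then of_int k else (0::complex))"
        by (simp add: letter_count_def kdelta_def)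
      thus "of_int (?c s) * ?z ^ s = of_nat N * ?z ^ s + (if s \<in> {..<\<nu>} then ?z ^ s else 0) -
          (if s = 0 then of_int k * ?z ^ s else 0) + (if s = t - 1 then of_int k * ?z ^ s else 0)"
        by (simp only: distrib_right left_diff_distrib if_distrib[of "\<lambda>x. x * ?z ^ s"] mult_1 mult_zero_left)
    qed
    also have "(\<Sum>s<t. if s \<in> {..<\<nu>} then ?z ^ s else 0) = (\<Sum>s\<in>{..<t} \<inter> {..<\<nu>}. ?z ^ s)"
      by (rule sum.inter_restrict[symmetric]) simp
    also have "{..<t} \<inter> {..<\<nu>} = {..<\<nu>}" using assms(2) by auto
    finally show ?thesis
      unfolding block using t by (simp add: full inv algebra_simps)
  qed
  have W: "?W = (\<Sum>s<t. of_int (int (count_list w s)) * ?z ^ s)"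
    using sum_list_map_eq_sum_count_list[OF w(1)] by simp
  have "(1 - inverse ?z) * GBG_rank t (word_part t \<nu> w) = (\<Sum>j<?M. ?z ^ j) - ?W"
    using GBG_rank_word_part[of t w \<nu>] t w z by (simp add: zM power_inverse)
  moreover have "1 - inverse ?z \<noteq> 0" using z1 by (metis eq_iff_diff_eq_0 inverse_1 inverse_inverse_eq)
  ultimately have "GBG_rank t (word_part t \<nu> w) = of_int k \<longleftrightarrow>
     (\<Sum>j<?M. ?z ^ j) - ?W = (1 - inverse ?z) * of_int k"
    by (metis mult_cancel_left)
  also have "\<dots> \<longleftrightarrow> ?W - (\<Sum>s<t. of_int (?c s) * ?z ^ s) = 0"
    unfolding c by (auto simp: algebra_simps)
  also have "?W - (\<Sum>s<t. of_int (?c s) * ?z ^ s) =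
     (\<Sum>s<t. of_int (int (count_list w s) - ?c s) * ?z ^ s)"
    unfolding W sum_subtractf[symmetric] by (rule sum.cong) (auto simp: algebra_simps)
  also have "\<dots> = 0 \<longleftrightarrow>
     (\<forall>s<t. int (count_list w s) - ?c s = int (count_list w (t - 1)) - ?c (t - 1))"
    using assms(1) by (rule root_of_unity_sum_eq_0_iff)
  also have "\<dots> \<longleftrightarrow> (\<forall>s<t. int (count_list w s) = ?c s)"
  proof
    define d where "d = int (count_list w (t - 1)) - ?c (t - 1)"
    assume *: "\<forall>s<t. int (count_list w s) - ?c s = int (count_list w (t - 1)) - ?c (t - 1)"
    have "(\<Sum>s<t. count_list w s) = length w"
      using size_eq_sum_count[of "mset w" t] w(1) by (simp add: count_mset)
    hence "(\<Sum>s<t. int (count_list w s)) = int ?M" using w(2) by (simp flip: of_nat_sum)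
    moreover have "(\<Sum>s<t. ?c s) = int ?M" using t assms(2) by (rule sum_letter_count)
    ultimately have "(\<Sum>s<t. int (count_list w s) - ?c s) = 0"
      unfolding sum_subtractf by simp
    moreover have d: "int (count_list w s) - ?c s = d" if "s < t" for s
      unfolding d_def using * that by blast
    hence "(\<Sum>s<t. int (count_list w s) - ?c s) = (\<Sum>s<t. d)"
      by (intro sum.cong) simp_all
    ultimately have "d = 0" using t by simp
    with d show "\<forall>s<t. int (count_list w s) = ?c s" by simp
  next
    assume "\<forall>s<t. int (count_list w s) = ?c s"
    hence "int (count_list w s) - ?c s = 0" if "s < t" for s using that by simp
    from this this[of "t - 1"] t
    show "\<forall>s<t. int (count_list w s) - ?c s = int (count_list w (t - 1)) - ?c (t - 1)" by simp
  qed
  finally show ?thesis .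
qed

lemma GBG_partitions_eq_image:
  assumes "prime t" "\<nu> < t"
  shows "GBG_partitions (t * N + \<nu>) t k = word_part t \<nu> `
    {w \<in> words t (t * N + \<nu>). \<forall>s<t. int (count_list w s) = letter_count t N \<nu> k s}"
proof -
  have "GBG_partitions (t * N + \<nu>) t k =
     {\<pi> \<in> bounded_partitions t (t * N + \<nu>). GBG_rank t \<pi> = of_int k}"
    by (auto simp: GBG_partitions_def bounded_partitions_def)
  also have "\<dots> = word_part t \<nu> ` {w \<in> words t (t * N + \<nu>). GBG_rank t (word_part t \<nu> w) = of_int k}"
    unfolding bij_betw_imp_surj_on[OF bij_betw_word_part[OF assms(2)], symmetric] by auto
  also have "{w \<in> words t (t * N + \<nu>). GBG_rank t (word_part t \<nu> w) = of_int k} =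
     {w \<in> words t (t * N + \<nu>). \<forall>s<t. int (count_list w s) = letter_count t N \<nu> k s}"
    using GBG_rank_word_part_eq_iff[OF assms] by blast
  finally show ?thesis .
qed

section \<open>Assembly of the generating function\<close>

lemma fps_nth_0_qpoch:
  fixes a :: "'a::comm_ring_1 fps"
  assumes "fps_nth a 0 = 0"
  shows "fps_nth (qpoch a a L) 0 = 1"
proof (induction L)
  case (Suc L)
  thus ?case unfolding qpoch_Suc by (simp add: fps_mult_nth_0 assms)
qed (simp add: qpoch_def)

theorem theorem1p4:
  fixes t N \<nu> :: nat and k :: int and qt :: "rat fps"
  assumes "prime t" and "\<nu> \<in> {0..t - 1}"
  defines "qt \<equiv> fps_X ^ t"
  shows "GBG_gf (t * N + \<nu>) t k =
           fps_X ^ nat (int t * k\<^sup>2 - (int t - 1) * k) * qpoch qt qt (t * N + \<nu>) *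
           (\<Prod>i = 0..t - 1.
              inv_qpoch qt (int N + \<lceil>(real \<nu> - real i) / real t\<rceil>
                             - k * kdelta i 0 + k * kdelta i (t - 1)))"
proof -
  have t: "t > 1" by (rule prime_gt_1_nat) fact
  have \<nu>: "\<nu> < t" using assms(2) t by auto
  let ?M = "t * N + \<nu>" and ?c = "letter_count t N \<nu> k"
  let ?e = "nat (int t * k\<^sup>2 - (int t - 1) * k)"
  let ?W = "{w \<in> words t ?M. \<forall>s<t. int (count_list w s) = ?c s}"
  have "{0..t - 1} = {..<t}" using t by auto
  hence prod: "(\<Prod>i = 0..t - 1. inv_qpoch qt (int N + \<lceil>(real \<nu> - real i) / real t\<rceil>
          - k * kdelta i 0 + k * kdelta i (t - 1))) = (\<Prod>s<t. inv_qpoch qt (?c s))"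
    by (intro prod.cong) (auto simp: letter_count_def ceiling_quotient_letter \<nu>)
  have "inj_on (word_part t \<nu>) ?W"
    by (rule inj_on_subset[OF inj_on_word_part[OF \<nu>]]) auto
  hence gf: "GBG_gf ?M t k = (\<Sum>w\<in>?W. fps_X ^ sum_list (word_part t \<nu> w))"
    by (simp add: GBG_gf_def GBG_partitions_eq_image[OF assms(1) \<nu>] norm_part_def sum.reindex)
  show ?thesis
  proof (cases "\<exists>s<t. ?c s < 0")
    \<comment> \<open>No word has a negative letter count, and by convention the right-hand side
      vanishes as well.\<close>
    case True
    then obtain s where s: "s < t" "?c s < 0" by blast
    hence empty: "?W = {}" by force
    have "(\<Prod>s<t. inv_qpoch qt (?c s)) = 0"
      using s by (intro prod_zero) (auto simp: inv_qpoch_def)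
    thus ?thesis unfolding prod gf empty by simp
  next
    case False
    hence nonneg: "?c s \<ge> 0" if "s < t" for s using that by force
    define m where "m = (\<Sum>s<t. replicate_mset (nat (?c s)) s)"
    have cm: "count m s = (if s < t then nat (?c s) else 0)" for s
      by (simp add: m_def count_sum)
    hence cnt: "int (count m s) = ?c s" if "s < t" for s using nonneg that by simp
    have m: "set_mset m \<subseteq> {..<t}"
      using cm by (auto simp flip: count_greater_zero_iff split: if_splits)
    have "int (size m) = (\<Sum>s<t. ?c s)"
      unfolding size_eq_sum_count[OF m] of_nat_sum by (rule sum.cong) (auto simp: cnt)
    also have "\<dots> = int ?M" using t \<nu> by (rule sum_letter_count)
    finally have size: "size m = ?M" by (simp only: of_nat_eq_iff)
    have "?W = permutations_of_multiset m"
    proof (intro equalityI subsetI)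
      fix w assume w: "w \<in> ?W"
      hence "count_list w s = count m s" for s
        using cm[of s] by (cases "s < t") (auto simp: words_def count_list_0_iff nat_eq_iff2)
      thus "w \<in> permutations_of_multiset m"
        by (intro permutations_of_multisetI multiset_eqI) (simp add: count_mset)
    next
      fix w assume "w \<in> permutations_of_multiset m"
      hence w: "mset w = m" by (rule permutations_of_multisetD)
      hence "set w \<subseteq> {..<t}" "length w = ?M"
        using m size by (metis set_mset_mset, metis size_mset)
      thus "w \<in> ?W" using w cnt by (auto simp: words_def simp flip: count_mset)
    qed
    hence gf': "GBG_gf ?M t k = word_gf fps_X t \<nu> m" by (simp add: gf word_gf_def)
    let ?P = "\<Prod>s<t. qpoch qt qt (count m s)" and ?K = "sum_mset m + \<Sum>{..size m}"
    have e: "size m * \<nu> + t * ((\<Sum>s<t. count m s choose 2) + (\<Sum>s\<in>{\<nu>..<t}. count m s)) = ?K + ?e"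
      using exponent_identity[OF t \<nu> m] cnt by blast
    have "word_gf fps_X t \<nu> m * fps_X ^ ?K * ?P = fps_X ^ (?K + ?e) * qpoch qt qt (size m)"
      using word_gf_closed[OF m \<nu>, of "fps_X :: rat fps"]
      unfolding e qt_def .
    hence "fps_X ^ ?K * (word_gf fps_X t \<nu> m * ?P) = fps_X ^ ?K * (fps_X ^ ?e * qpoch qt qt ?M)"
      by (simp only: power_add size mult_ac)
    \<comment> \<open>Power series over a field form an integral domain, so the power of the
      indeterminate cancels.\<close>
    hence eq: "word_gf fps_X t \<nu> m * ?P = fps_X ^ ?e * qpoch qt qt ?M"
      by (simp only: mult_cancel_left) simp
    \<comment> \<open>Each factor of \<open>?P\<close> has constant term 1, so its formal inverse is
      a true inverse.\<close>
    have "?P * (\<Prod>s<t. inv_qpoch qt (?c s)) = (\<Prod>s<t. 1)"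
      unfolding prod.distrib[symmetric]
    proof (rule prod.cong[OF refl])
      fix s assume "s \<in> {..<t}"
      hence "inv_qpoch qt (?c s) = inverse (qpoch qt qt (count m s))"
        using nonneg[of s] cm[of s] by (simp add: inv_qpoch_def)
      moreover have "fps_nth (qpoch qt qt (count m s)) 0 \<noteq> 0"
        using t by (simp add: fps_nth_0_qpoch qt_def)
      ultimately show "qpoch qt qt (count m s) * inv_qpoch qt (?c s) = 1"
        by (simp add: inverse_mult_eq_1')
    qed
    hence "word_gf fps_X t \<nu> m = word_gf fps_X t \<nu> m * ?P * (\<Prod>s<t. inv_qpoch qt (?c s))"
      by (simp add: mult.assoc)
    thus ?thesis unfolding gf' prod eq .
  qed
qed

end
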